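(* Let $(s,\vec r)$ be a molecule with $N$ atoms and pairwise distinct positions, and let $r_c>\max_{i,j}\|\vec r_i-\vec r_j\|$, so that every local environment contains all atoms. Let $g$ be a function from local environments to $\mathbb{R}^{3\times 3}$ which is $\mathrm{O}(3)$-equivariant and such that $g(A)$ has rank $3$ for every local environment $A$ for which no $o\in\mathrm{O}(3)$, $o\neq I$, satisfies $\{(s',xo^T):(s',x)\in A\}=A$. Define $\vec E_i=g(\{(s_j,\vec r_i-\vec r_j): j=1,\dots,N\})$ and $\vec E=\sum_{i=1}^N\vec E_i$. If $\mathrm{rank}(\vec E_i)<3$ for some $i$, then $\mathrm{rank}(\vec E)<3$.
   Context: $s\in\mathbb{R}^{N\times d}$ and $\vec r\in\mathbb{R}^{N\times3}$ have rows $s_i$ and $\vec r_i\in\mathbb{R}^{1\times 3}$. $\mathrm{O}(3)=\{Q\in\mathbb{R}^{3\times3}:QQ^T=I\}$ and $I$ is the identity. A local environment is a finite set of pairs $(s',x)$ with $s'\in\mathbb{R}^d$, $x\in\mathbb{R}^{1\times 3}$. $g$ being $\mathrm{O}(3)$-equivariant means $g(\{(s',xo^T):(s',x)\in A\})=g(A)o^T$ for all $o\in\mathrm{O}(3)$ and all local environments $A$. *)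

theory Defs
  imports "HOL-Analysis.Analysis"
begin

text \<open>A local environment is a finite set of pairs (s', x) with s' in R^d and x a row
  vector in R^{1x3} (represented as real^3). The orthogonal group acts by x \<mapsto> x Q^T.\<close>

type_synonym 'd local_env = "((real^'d) \<times> (real^3)) set"

definition act_env :: "real^3^3 \<Rightarrow> 'd local_env \<Rightarrow> 'd local_env" where
  "act_env Q A = (\<lambda>(s', x). (s', x v* transpose Q)) ` A"

definition O3_equivariant :: "('d local_env \<Rightarrow> real^3^3) \<Rightarrow> bool" where
  "O3_equivariant g \<longleftrightarrow>
     (\<forall>Q A. orthogonal_matrix Q \<longrightarrow> finite A \<longrightarrow> g (act_env Q A) = g A ** transpose Q)"

text \<open>A has trivial symmetry group: no orthogonal Q other than the identity fixes A.\<close>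
definition trivial_stabilizer :: "'d local_env \<Rightarrow> bool" where
  "trivial_stabilizer A \<longleftrightarrow>
     \<not> (\<exists>Q. orthogonal_matrix Q \<and> Q \<noteq> mat 1 \<and> act_env Q A = A)"

definition environment :: "('n \<Rightarrow> real^'d) \<Rightarrow> ('n \<Rightarrow> real^3) \<Rightarrow> 'n \<Rightarrow> 'd local_env" where
  "environment s r i = (\<lambda>j. (s j, r i - r j)) ` UNIV"

end

theory Submission
  imports Defs
begin

text \<open>If the environment of atom i is fixed by some Q \<noteq> I, then Q relabels the atoms: the atom j'
  with r i - r j' = Q (r i - r j) exists by invariance, is unique because positions are distinct,
  and this relabelling p is a permutation with environment (p k) = Q \<cdot> environment k for every k,
  since r (p k) - r (p j) = Q (r k - r j). By equivariance the total E is then fixed by Q,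
  E = E Q^T; were E of full rank it could be cancelled, forcing Q = I.\<close>

lemma sum_matrix_mult_right:
  fixes A :: "'i \<Rightarrow> 'a::semiring_1^'n^'m" and B :: "'a^'p^'n"
  assumes "finite S"
  shows "(\<Sum>k\<in>S. A k) ** B = (\<Sum>k\<in>S. A k ** B)"
  using assms
proof (induction S rule: finite_induct)
  case (insert k S)
  have "(A k + (\<Sum>k\<in>S. A k)) ** B = A k ** B + (\<Sum>k\<in>S. A k) ** B"
    by (vector matrix_matrix_mult_def sum.distrib[symmetric] distrib_right)
  with insert show ?case by simp
qed simp

lemma full_rank_mult_right_fixed:
  fixes E :: "real^'n^'m" and M :: "real^'n^'n"
  assumes "rank E = CARD('n)" and "E ** M = E"
  shows "M = mat 1"
proof -
  obtain B where B: "B ** E = mat 1"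
    using assms(1) full_rank_injective matrix_left_invertible_injective by blast
  have "M = (B ** E) ** M" by (simp add: B)
  also have "\<dots> = B ** E" by (simp flip: matrix_mul_assoc add: assms(2))
  finally show ?thesis by (simp add: B)
qed

lemma act_env_environment:
  "act_env Q (environment s r i) = (\<lambda>j. (s j, Q *v (r i - r j))) ` UNIV"
  unfolding act_env_def environment_def by (simp add: image_image)

lemma environment_symmetry_permutes_atoms:
  fixes s :: "'n::finite \<Rightarrow> real^'d" and r :: "'n \<Rightarrow> real^3"
  assumes "inj r" and "orthogonal_matrix Q"
    and fixed: "act_env Q (environment s r i) = environment s r i"
  obtains p where "bij p" and "\<And>k. environment s r (p k) = act_env Q (environment s r k)"
proof -
  have "\<forall>j. \<exists>j'. s j' = s j \<and> r i - r j' = Q *v (r i - r j)"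
  proof
    fix j
    have "(s j, Q *v (r i - r j)) \<in> act_env Q (environment s r i)"
      by (simp add: act_env_environment)
    then have "(s j, Q *v (r i - r j)) \<in> environment s r i"
      by (simp only: fixed)
    then show "\<exists>j'. s j' = s j \<and> r i - r j' = Q *v (r i - r j)"
      by (auto simp: environment_def)
  qed
  then obtain p where p: "\<And>j. s (p j) = s j" "\<And>j. r i - r (p j) = Q *v (r i - r j)"
    by metis
  have "inj ((*v) Q)"
    using \<open>orthogonal_matrix Q\<close> matrix_left_invertible_injective orthogonal_matrix by blast
  have "inj p"
  proof (rule injI)
    fix a b assume "p a = p b"
    then have "Q *v (r i - r a) = Q *v (r i - r b)"
      using p(2)[of a] p(2)[of b] by simp
    with \<open>inj ((*v) Q)\<close> \<open>inj r\<close> show "a = b"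
      by (simp add: inj_eq)
  qed
  then have "bij p"
    by (simp add: bij_def finite_UNIV_inj_surj)
  have relative: "r (p k) - r (p j) = Q *v (r k - r j)" for j k
  proof -
    have "r (p k) - r (p j) = (r i - r (p j)) - (r i - r (p k))" by simp
    also have "\<dots> = Q *v ((r i - r j) - (r i - r k))"
      by (simp add: p(2) matrix_vector_mult_diff_distrib)
    finally show ?thesis by simp
  qed
  have "environment s r (p k) = act_env Q (environment s r k)" for k
  proof -
    have "environment s r (p k) = (\<lambda>j. (s j, r (p k) - r j)) ` range p"
      using \<open>bij p\<close> unfolding environment_def by (simp add: bij_is_surj)
    also have "\<dots> = (\<lambda>j. (s (p j), r (p k) - r (p j))) ` UNIV"
      by (simp add: image_image)
    finally show ?thesis
      by (simp add: act_env_environment p(1) relative)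
  qed
  with \<open>bij p\<close> that show thesis by blast
qed

lemma sum_environments_fixed_by_symmetry:
  fixes s :: "'n::finite \<Rightarrow> real^'d" and r :: "'n \<Rightarrow> real^3"
    and g :: "'d local_env \<Rightarrow> real^3^3"
  assumes "inj r" and "O3_equivariant g" and "orthogonal_matrix Q"
    and "act_env Q (environment s r i) = environment s r i"
  shows "(\<Sum>k\<in>UNIV. g (environment s r k)) ** transpose Q = (\<Sum>k\<in>UNIV. g (environment s r k))"
proof -
  obtain p where "bij p" and p: "\<And>k. environment s r (p k) = act_env Q (environment s r k)"
    using environment_symmetry_permutes_atoms assms(1,3,4) by blast
  have "(\<Sum>k\<in>UNIV. g (environment s r k)) ** transpose Q
      = (\<Sum>k\<in>UNIV. g (act_env Q (environment s r k)))"
    using assms(2,3) unfolding O3_equivariant_def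
    by (simp add: sum_matrix_mult_right environment_def)
  also have "\<dots> = (\<Sum>k\<in>UNIV. g (environment s r (p k)))"
    by (simp add: p)
  also have "\<dots> = (\<Sum>k\<in>UNIV. g (environment s r k))"
    by (rule sum.reindex_bij_betw[OF \<open>bij p\<close>])
  finally show ?thesis .
qed

theorem corollary1:
  fixes s :: "'n::finite \<Rightarrow> real^'d"
    and r :: "'n \<Rightarrow> real^3"
    and rc :: real
    and g :: "'d local_env \<Rightarrow> real^3^3"
  assumes distinct_pos: "inj r"
    and cutoff: "\<forall>i j. norm (r i - r j) < rc"
    and equiv: "O3_equivariant g"
    and full_rank: "\<forall>A. finite A \<longrightarrow> trivial_stabilizer A \<longrightarrow> rank (g A) = 3"
    and some_deficient: "\<exists>i. rank (g (environment s r i)) < 3"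
  shows "rank (\<Sum>i\<in>UNIV. g (environment s r i)) < 3"
proof (rule ccontr)
  assume full: "\<not> ?thesis"
  obtain i where "rank (g (environment s r i)) < 3"
    using some_deficient by blast
  then have "\<not> trivial_stabilizer (environment s r i)"
    using full_rank by (auto simp: environment_def)
  then obtain Q where Q: "orthogonal_matrix Q" "Q \<noteq> mat 1"
    and fixed: "act_env Q (environment s r i) = environment s r i"
    unfolding trivial_stabilizer_def by blast
  have "rank (\<Sum>i\<in>UNIV. g (environment s r i)) = CARD(3)"
    using full rank_bound[of "\<Sum>i\<in>UNIV. g (environment s r i)"] by simp
  then have "transpose Q = mat 1"
    using full_rank_mult_right_fixed
      sum_environments_fixed_by_symmetry[OF distinct_pos equiv Q(1) fixed] by blast
  then show False
    using Q(2) by (metis transpose_mat transpose_transpose)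
qed

end
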